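(* Let $1\le k\le n$. The forest $F_n^k$ consisting of a star $K_{1,n-k}$ together with $k-1$ isolated vertices is the unique forest in $\mathcal{F}_n^k$ with minimum energy, and its energy is $2\sqrt{n-k}$.
   Context: $\mathcal{F}_n^k$ denotes the set of (simple, unweighted) forests with $n$ vertices and exactly $k$ connected components. The energy of a graph is the sum of the absolute values of the eigenvalues of its adjacency matrix. $K_{1,p}$ is the star on $p+1$ vertices (with $K_{1,0}=K_1$). Uniqueness is up to isomorphism. *)

theory Defs
  imports "Graph_Theory.Graph_Theory" "Jordan_Normal_Form.Spectral_Radius"
begin

text \<open>
  A finite simple graph is a \<^locale>\<open>pair_graph\<close>: a finite, loop-free, symmetric digraph
  without parallel arcs, where the edge between \<open>u\<close> and \<open>v\<close> is the pair of arcs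
  \<open>(u, v)\<close>, \<open>(v, u)\<close>.
  The closed walk along \<open>(u, v)\<close>, \<open>(v, u)\<close> is a \<open>cycle\<close> of the underlying digraph but not of
  the simple graph, so the library's \<open>forest\<close> (no directed cycle at all) would exclude every edge;
  the cycles of the simple graph are exactly the directed cycles of length at least 3.
\<close>

definition simple_forest :: "'a pair_pre_digraph \<Rightarrow> bool" where
  "simple_forest G \<longleftrightarrow>
     pair_graph G \<and> \<not> (\<exists>p. pre_digraph.cycle (with_proj G) p \<and> 3 \<le> length p)"

text \<open>For a symmetric digraph the strongly connected components are the connected components.\<close>

definition forests :: "nat \<Rightarrow> nat \<Rightarrow> 'a pair_pre_digraph set" where
  "forests n k = {G. simple_forest G \<and> card (pverts G) = n
                     \<and> card (pre_digraph.sccs_verts (with_proj G)) = k}"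

definition star :: "nat \<Rightarrow> nat pair_pre_digraph" where
  "star p = \<lparr> pverts = {0..p}, parcs = {0} \<times> {1..p} \<union> {1..p} \<times> {0} \<rparr>"

definition star_forest :: "nat \<Rightarrow> nat \<Rightarrow> nat pair_pre_digraph" where
  "star_forest n k =
     \<lparr> pverts = pverts (star (n - k)) \<union> {n - k<..<n}, parcs = parcs (star (n - k)) \<rparr>"

definition adjacency_matrix :: "'a pair_pre_digraph \<Rightarrow> 'a list \<Rightarrow> complex mat" where
  "adjacency_matrix G vs =
     Matrix.mat (length vs) (length vs) (\<lambda>(i, j). if (vs ! i, vs ! j) \<in> parcs G then 1 else 0)"

text \<open>Eigenvalues are counted with their algebraic multiplicity.\<close>

definition matrix_energy :: "complex mat \<Rightarrow> real" where
  "matrix_energy A = (\<Sum>\<mu>\<in>spectrum A. real (Polynomial.order \<mu> (char_poly A)) * cmod \<mu>)"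

text \<open>
  The enumeration of the vertices is arbitrary; \<open>graph_energy_eq\<close> below shows that every
  enumeration gives the same value.
\<close>

definition graph_energy :: "'a pair_pre_digraph \<Rightarrow> real" where
  "graph_energy G = matrix_energy (adjacency_matrix G (SOME vs. distinct vs \<and> set vs = pverts G))"

lemma similar_mat_reindex:
  fixes A B :: "complex mat"
  assumes A: "A \<in> carrier_mat n n" and B: "B \<in> carrier_mat n n"
    and bij: "bij_betw f {..<n} {..<n}"
    and AB: "\<And>i j. i < n \<Longrightarrow> j < n \<Longrightarrow> B $$ (i, j) = A $$ (f i, f j)"
  shows "similar_mat B A"
proof -
  define P :: "complex mat" where "P = Matrix.mat n n (\<lambda>(i, j). if j = f i then 1 else 0)"
  define Q :: "complex mat" where "Q = Matrix.mat n n (\<lambda>(i, j). if i = f j then 1 else 0)"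
  have P: "P \<in> carrier_mat n n" and Q: "Q \<in> carrier_mat n n" by (auto simp: P_def Q_def)
  have f: "f i < n" if "i < n" for i using bij that by (auto simp: bij_betw_def)
  have inj: "f i = f j \<longleftrightarrow> i = j" if "i < n" "j < n" for i j
    using bij that by (auto simp: bij_betw_def inj_on_def)
  have PX: "(P * X) $$ (i, j) = X $$ (f i, j)" if "X \<in> carrier_mat n n" "i < n" "j < n" for X i j
  proof -
    have "(P * X) $$ (i, j) = (\<Sum>l\<in>{0..<n}. (if l = f i then 1 else 0) * X $$ (l, j))"
      using that by (auto simp: P_def scalar_prod_def)
    also have "\<dots> = (\<Sum>l\<in>{0..<n}. if l = f i then X $$ (l, j) else 0)"
      by (intro sum.cong) auto
    also have "\<dots> = X $$ (f i, j)" using f[OF that(2)] by (simp add: sum.delta)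
    finally show ?thesis .
  qed
  have XQ: "(X * Q) $$ (i, j) = X $$ (i, f j)" if "X \<in> carrier_mat n n" "i < n" "j < n" for X i j
  proof -
    have "(X * Q) $$ (i, j) = (\<Sum>l\<in>{0..<n}. X $$ (i, l) * (if l = f j then 1 else 0))"
      using that by (auto simp: Q_def scalar_prod_def)
    also have "\<dots> = (\<Sum>l\<in>{0..<n}. if l = f j then X $$ (i, l) else 0)"
      by (intro sum.cong) auto
    also have "\<dots> = X $$ (i, f j)" using f[OF that(3)] by (simp add: sum.delta)
    finally show ?thesis .
  qed
  have PQ: "P * Q = 1\<^sub>m n"
  proof (rule eq_matI)
    fix i j assume "i < dim_row (1\<^sub>m n :: complex mat)" "j < dim_col (1\<^sub>m n :: complex mat)"
    then have ij: "i < n" "j < n" by auto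
    then have "(P * Q) $$ (i, j) = Q $$ (f i, j)" using Q by (intro PX) auto
    then show "(P * Q) $$ (i, j) = 1\<^sub>m n $$ (i, j)" using ij f by (simp add: Q_def inj)
  qed (use P Q in auto)
  have QP: "Q * P = 1\<^sub>m n" using mat_mult_left_right_inverse[OF P Q PQ] .
  have PAQ: "B = P * A * Q"
  proof (rule eq_matI)
    fix i j assume "i < dim_row (P * A * Q)" "j < dim_col (P * A * Q)"
    then have ij: "i < n" "j < n" using P Q by auto
    have "(P * A * Q) $$ (i, j) = (P * A) $$ (i, f j)"
      using ij P A by (intro XQ) auto
    also have "\<dots> = A $$ (f i, f j)" using ij f A by (intro PX) auto
    finally show "B $$ (i, j) = (P * A * Q) $$ (i, j)" using AB ij by simp
  qed (use B P Q in auto)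
  show ?thesis
    unfolding similar_mat_def
    by (rule exI[of _ P], rule exI[of _ Q], rule similar_mat_witI[of _ _ n]) (fact PQ QP PAQ A B P Q)+
qed

lemma matrix_energy_similar:
  assumes A: "A \<in> carrier_mat n n" and B: "B \<in> carrier_mat n n" and "similar_mat B A"
  shows "matrix_energy B = matrix_energy A"
  using char_poly_similar[OF assms(3)]
  by (simp add: matrix_energy_def spectrum_root_char_poly[OF A] spectrum_root_char_poly[OF B])

lemma graph_energy_eq:
  assumes vs: "distinct vs" "set vs = pverts G"
  shows "graph_energy G = matrix_energy (adjacency_matrix G vs)"
proof -
  define ws where "ws = (SOME ws. distinct ws \<and> set ws = pverts G)"
  have ws: "distinct ws" "set ws = pverts G"
    using someI[of "\<lambda>ws. distinct ws \<and> set ws = pverts G" vs] vs by (auto simp: ws_def)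
  have len: "length ws = length vs"
    using vs ws by (metis distinct_card)
  have bv: "bij_betw ((!) vs) {..<length vs} (pverts G)" using bij_betw_nth[OF vs(1)] vs by auto
  have bw: "bij_betw ((!) ws) {..<length vs} (pverts G)" using bij_betw_nth[OF ws(1)] ws len by auto
  define f where "f = the_inv_into {..<length vs} ((!) vs) \<circ> (!) ws"
  have f: "bij_betw f {..<length vs} {..<length vs}"
    unfolding f_def using bw bij_betw_the_inv_into[OF bv] by (rule bij_betw_trans)
  have fi: "vs ! f i = ws ! i" if "i < length vs" for i
    using f_the_inv_into_f_bij_betw[OF bv] bw that by (auto simp: f_def bij_betw_def)
  have "similar_mat (adjacency_matrix G ws) (adjacency_matrix G vs)"
  proof (rule similar_mat_reindex[OF _ _ f])
    fix i j assume "i < length vs" "j < length vs"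
    moreover from this have "f i < length vs" "f j < length vs" using f by (auto simp: bij_betw_def)
    ultimately show "adjacency_matrix G ws $$ (i, j) = adjacency_matrix G vs $$ (f i, f j)"
      by (simp add: adjacency_matrix_def len fi)
  qed (auto simp: adjacency_matrix_def len)
  then show ?thesis
    unfolding graph_energy_def ws_def[symmetric]
    by (intro matrix_energy_similar[of _ "length vs"]) (auto simp: adjacency_matrix_def len)
qed

end

theory Submission
  imports Defs
begin

text \<open>
  The eigenvalues \<open>\<lambda>\<^sub>1, \<dots>, \<lambda>\<^sub>n\<close> of a graph with \<open>m\<close> edges satisfy \<open>\<Sum> \<lambda>\<^sub>i = 0\<close> and
  \<open>\<Sum> \<lambda>\<^sub>i\<^sup>2 = 2 m\<close>. The first identity gives \<open>\<bar>\<lambda>\<^sub>i\<bar> \<le> E / 2\<close> for the energy \<open>E\<close>, so the second one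
  gives \<open>2 m \<le> E\<^sup>2 / 2\<close>, that is \<open>E \<ge> 2 \<surd>m\<close>. Equality holds iff \<open>\<lambda>\<^sub>i\<^sup>3 = m \<lambda>\<^sub>i\<close> for all \<open>i\<close>, that is
  iff the adjacency matrix satisfies \<open>A\<^sup>3 = m A\<close>: there are \<open>m\<close> walks of length 3 between adjacent
  vertices and none between non-adjacent ones. In a forest with an edge the latter rules out a path
  of length 3, so every edge has a leaf, and counting the walks along an edge from its other end
  shows that this end has degree \<open>m\<close>. Any graph with \<open>n\<close> vertices and \<open>k\<close> components has
  \<open>m \<ge> n - k\<close>.
\<close>

section \<open>The energy of a real symmetric matrix of trace zero\<close>

definition mat_trace :: "'a::comm_ring_1 mat \<Rightarrow> 'a" where
  "mat_trace A = (\<Sum>i<dim_row A. A $$ (i, i))"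

lemma index_mult_mat_sum:
  assumes "A \<in> carrier_mat n m" "B \<in> carrier_mat m k" "i < n" "j < k"
  shows "(A * B) $$ (i, j) = (\<Sum>l<m. A $$ (i, l) * B $$ (l, j))"
  using assms by (auto simp: scalar_prod_def lessThan_atLeast0 intro!: sum.cong)

lemma mat_trace_mult:
  assumes "A \<in> carrier_mat n m" "B \<in> carrier_mat m n"
  shows "mat_trace (A * B) = (\<Sum>i<n. \<Sum>l<m. A $$ (i, l) * B $$ (l, i))"
  unfolding mat_trace_def using assms
  by (auto simp: index_mult_mat_sum[of _ n m] simp del: index_mult_mat(1) intro!: sum.cong)

lemma mat_trace_mult_comm:
  assumes "A \<in> carrier_mat n m" "B \<in> carrier_mat m n"
  shows "mat_trace (A * B) = mat_trace (B * A)"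
  unfolding mat_trace_mult[OF assms] mat_trace_mult[OF assms(2,1)]
  by (subst sum.swap) (simp add: mult.commute)

lemma mat_trace_similar:
  assumes "similar_mat_wit A B P Q"
  shows "mat_trace A = mat_trace B"
proof -
  define n where "n = dim_row A"
  note w = similar_mat_witD[OF n_def assms]
  have "mat_trace A = mat_trace (P * (B * Q))"
    using w by (simp add: assoc_mult_mat[of _ n n _ n _ n])
  also have "\<dots> = mat_trace (B * Q * P)"
    using w by (intro mat_trace_mult_comm[of _ n n]) auto
  also have "B * Q * P = B"
    using w by (simp add: assoc_mult_mat[of _ n n _ n _ n])
  finally show ?thesis .
qed

text \<open>With a common pair \<open>P\<close>, \<open>Q\<close> the inner factor
  \<open>Q * P\<close> cancels. Keeping the witnesses fixed lets one triangularization of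
  \<open>A\<close> serve also for \<open>A * A * A\<close> and for its difference with a multiple of
  \<open>A\<close>.\<close>

lemma similar_mat_wit_mult:
  assumes "similar_mat_wit A B P Q" "similar_mat_wit A' B' P Q"
  shows "similar_mat_wit (A * A') (B * B') P Q"
proof -
  define n where "n = dim_row A"
  note w = similar_mat_witD[OF n_def assms(1)]
  have "n = dim_row A'"
    using w(6) similar_mat_witD(6)[OF refl assms(2)] by auto
  note w' = similar_mat_witD[OF this assms(2)]
  have "A * A' = P * B * (Q * P) * B' * Q"
    unfolding w(3) w'(3) using w(4-) w'(4-) by (simp add: assoc_mult_mat[of _ n n _ n _ n])
  also have "\<dots> = P * (B * B') * Q"
    using w w' by (simp add: assoc_mult_mat[of _ n n _ n _ n])
  finally show ?thesis
    using w w' by (intro similar_mat_witI[of _ _ n]) auto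
qed

lemma similar_mat_wit_diff:
  fixes A A' :: "'a::comm_ring_1 mat"
  assumes "similar_mat_wit A B P Q" "similar_mat_wit A' B' P Q"
  shows "similar_mat_wit (A - A') (B - B') P Q"
proof -
  define n where "n = dim_row A"
  note w = similar_mat_witD[OF n_def assms(1)]
  have "n = dim_row A'"
    using w(6) similar_mat_witD(6)[OF refl assms(2)] by auto
  note w' = similar_mat_witD[OF this assms(2)]
  have "P * (B - B') * Q = A - A'"
    unfolding w(3) w'(3) using w(4-) w'(4-)
    by (simp add: mult_minus_distrib_mat[of _ n n _ n] minus_mult_distrib_mat[of _ n n _ _ n])
  then show ?thesis
    using w w' by (intro similar_mat_witI[of _ _ n]) auto
qed

section \<open>Triangular matrices and their energy\<close>

lemma upper_triangular_mult:
  fixes A B :: "'a::comm_ring_1 mat"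
  assumes A: "A \<in> carrier_mat n n" "upper_triangular A"
    and B: "B \<in> carrier_mat n n" "upper_triangular B"
  shows "upper_triangular (A * B)"
    and "i < n \<Longrightarrow> (A * B) $$ (i, i) = A $$ (i, i) * B $$ (i, i)"
proof -
  \<comment> \<open>A nonzero term needs \<open>i <= l\<close> for \<open>A\<close> and
    \<open>l <= j\<close> for \<open>B\<close>; with \<open>j <= i\<close> this leaves only
    \<open>i = l = j\<close>.\<close>
  have zero: "A $$ (i, l) * B $$ (l, j) = 0" if "i < n" "l < n" "l \<noteq> i \<or> l \<noteq> j" "j \<le> i" for i j l
  proof (cases "l < i")
    case True
    then show ?thesis using A that by (auto dest: upper_triangularD)
  next
    case False
    then have "j < l" using that by auto
    then show ?thesis using B that by (auto dest: upper_triangularD)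
  qed
  show "upper_triangular (A * B)"
  proof (rule upper_triangularI)
    fix i j assume "j < i" "i < dim_row (A * B)"
    then have ij: "i < n" "j < n" "j < i" using A by auto
    then show "(A * B) $$ (i, j) = 0"
      unfolding index_mult_mat_sum[OF A(1) B(1) ij(1,2)]
      by (intro sum.neutral ballI zero) auto
  qed
  assume i: "i < n"
  have "(A * B) $$ (i, i) = (\<Sum>l<n. if l = i then A $$ (i, i) * B $$ (i, i) else 0)"
    unfolding index_mult_mat_sum[OF A(1) B(1) i i]
    using i by (intro sum.cong) (auto intro: zero)
  then show "(A * B) $$ (i, i) = A $$ (i, i) * B $$ (i, i)"
    using i by simp
qed

lemma upper_triangular_diff_smult:
  fixes A B :: "'a::comm_ring_1 mat"
  assumes A: "A \<in> carrier_mat n n" "upper_triangular A"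
    and B: "B \<in> carrier_mat n n" "upper_triangular B"
  shows "upper_triangular (A - c \<cdot>\<^sub>m B)"
  using A B by (intro upper_triangularI) (simp add: upper_triangularD)

text \<open>Turns algebraic multiplicities into numbers of occurrences on the diagonal of a
  triangular matrix.\<close>

lemma order_prod_linear:
  "Polynomial.order x (\<Prod>a\<leftarrow>as. [:- a, 1:]) = count_list as (x :: complex)"
proof (induction as)
  case (Cons a as)
  have "(\<Prod>a\<leftarrow>as. [:- a, 1:]) \<noteq> (0 :: complex poly)"
    by (auto simp: prod_list_zero_iff)
  then show ?case
    using Cons by (simp add: order_mult order_linear' del: mult_pCons_left)
qed simp

text \<open>Similarity preserves the characteristic polynomial, and that of \<open>U\<close> splits
  into linear factors given by its diagonal. The energy becomes a sum over positions, to which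
  elementary inequalities apply.\<close>

lemma matrix_energy_upper_triangular:
  assumes A: "A \<in> carrier_mat n n" and U: "U \<in> carrier_mat n n" "upper_triangular U"
    and sim: "similar_mat A U"
  shows "matrix_energy A = (\<Sum>i<n. cmod (U $$ (i, i)))"
proof -
  have cp: "char_poly A = (\<Prod>a\<leftarrow>diag_mat U. [:- a, 1:])"
    using char_poly_similar[OF sim] char_poly_upper_triangular[OF U] by simp
  have spec: "spectrum A = set (diag_mat U)"
    unfolding spectrum_root_char_poly[OF A] cp by (auto simp: poly_prod_list_zero_iff)
  \<comment> \<open>Positions are grouped by the value found there.\<close>
  have count: "(\<Sum>a\<leftarrow>as. cmod a) = (\<Sum>a\<in>set as. real (count_list as a) * cmod a)" for as
  proof -
    have "(\<Sum>a\<leftarrow>as. cmod a) = (\<Sum>i<length as. cmod (as ! i))"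
      by (simp add: sum_list_sum_nth lessThan_atLeast0)
    also have "\<dots> = (\<Sum>a\<in>set as. \<Sum>i | i < length as \<and> as ! i = a. cmod (as ! i))"
      by (subst sum.group[symmetric, of _ "set as" "(!) as"]) auto
    also have "\<dots> = (\<Sum>a\<in>set as. real (count_list as a) * cmod a)"
    proof (intro sum.cong refl)
      fix a
      have "count_list as a = card {i. i < length as \<and> as ! i = a}"
        unfolding count_list_eq_length_filter length_filter_conv_card
        by (rule arg_cong[of _ _ card]) auto
      then show "(\<Sum>i | i < length as \<and> as ! i = a. cmod (as ! i)) = real (count_list as a) * cmod a"
        by simp
    qed
    finally show ?thesis .
  qed
  have "matrix_energy A = (\<Sum>a\<in>set (diag_mat U). real (count_list (diag_mat U) a) * cmod a)"
    unfolding matrix_energy_def spec cp order_prod_linear ..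
  also have "\<dots> = (\<Sum>a\<leftarrow>diag_mat U. cmod a)"
    by (rule count[symmetric])
  also have "\<dots> = (\<Sum>i<n. cmod (U $$ (i, i)))"
    using U unfolding diag_mat_def
    by (simp add: o_def interv_sum_list_conv_sum_set_nat lessThan_atLeast0)
  finally show ?thesis .
qed

section \<open>An inequality for complex numbers with sum zero\<close>

text \<open>The real part of a square is at most the squared modulus, with equality only for real
  numbers, and the two sums force equality in every term. The eigenvalues come from a complex
  triangularization, so their reality in the equality case is derived here.\<close>

lemma sum_cmod_sq_eq:
  fixes f :: "'i \<Rightarrow> complex"
  assumes fin: "finite I" and sq: "(\<Sum>i\<in>I. (f i)\<^sup>2) = of_real (2 * m)"
    and le: "(\<Sum>i\<in>I. (cmod (f i))\<^sup>2) \<le> 2 * m" and i: "i \<in> I"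
  shows "(f i)\<^sup>2 = of_real ((cmod (f i))\<^sup>2)"
proof -
  have re: "Re ((f j)\<^sup>2) \<le> (cmod (f j))\<^sup>2" for j
    using complex_Re_le_cmod[of "(f j)\<^sup>2"] by (simp add: norm_power)
  have "(\<Sum>i\<in>I. Re ((f i)\<^sup>2)) = 2 * m"
    using arg_cong[OF sq, of Re] by simp
  then have "(\<Sum>j\<in>I. (cmod (f j))\<^sup>2 - Re ((f j)\<^sup>2)) \<le> 0"
    using le by (simp add: sum_subtractf)
  then have "(\<Sum>j\<in>I. (cmod (f j))\<^sup>2 - Re ((f j)\<^sup>2)) = 0"
    using re by (intro antisym sum_nonneg) auto
  then have *: "(cmod (f i))\<^sup>2 = Re ((f i)\<^sup>2)"
    using re i fin by (subst (asm) sum_nonneg_eq_0_iff) auto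
  then have "Im (f i) = 0"
    unfolding cmod_power2 Re_power2 by simp
  then show ?thesis
    by (simp add: complex_eq_iff cmod_power2)
qed

text \<open>Applied with the eigenvalues as \<open>f\<close> and the number of edges as
  \<open>m\<close>. As the values may be complex, the lower estimate of the sum of squared moduli is
  the triangle inequality for the sum of squares.\<close>

lemma sum_cmod_ge:
  fixes f :: "'i \<Rightarrow> complex"
  assumes fin: "finite I" and m: "0 \<le> m" and zero: "(\<Sum>i\<in>I. f i) = 0"
    and sq: "(\<Sum>i\<in>I. (f i)\<^sup>2) = of_real (2 * m)"
  shows "2 * sqrt m \<le> (\<Sum>i\<in>I. cmod (f i))"
    and "(\<Sum>i\<in>I. cmod (f i)) = 2 * sqrt m \<longleftrightarrow> (\<forall>i\<in>I. f i ^ 3 = of_real m * f i)"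
proof -
  define E where "E = (\<Sum>i\<in>I. cmod (f i))"
  have E0: "0 \<le> E" unfolding E_def by (intro sum_nonneg) auto
  \<comment> \<open>Each value is minus the sum of all the others, so its modulus is at most
    \<open>E - cmod (f i)\<close>.\<close>
  have half: "cmod (f i) \<le> E / 2" if "i \<in> I" for i
  proof -
    have "cmod (f i) = cmod (- (\<Sum>j\<in>I - {i}. f j))"
      using zero fin that by (simp add: sum.remove[of I i] add_eq_0_iff2)
    also have "\<dots> \<le> (\<Sum>j\<in>I - {i}. cmod (f j))"
      by (simp add: sum_norm_le)
    also have "\<dots> = E - cmod (f i)"
      unfolding E_def using fin that by (simp add: sum.remove[of I i])
    finally show ?thesis by simp
  qed
  have term_le: "(cmod (f i))\<^sup>2 \<le> E / 2 * cmod (f i)" if "i \<in> I" for i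
    unfolding power2_eq_square by (intro mult_right_mono half that) auto
  have upper: "(\<Sum>i\<in>I. (cmod (f i))\<^sup>2) \<le> E / 2 * E"
  proof -
    have "(\<Sum>i\<in>I. (cmod (f i))\<^sup>2) \<le> (\<Sum>i\<in>I. E / 2 * cmod (f i))"
      by (intro sum_mono term_le)
    then show ?thesis by (simp add: E_def sum_distrib_left)
  qed
  have lower: "2 * m \<le> (\<Sum>i\<in>I. (cmod (f i))\<^sup>2)"
  proof -
    have "2 * m = cmod (\<Sum>i\<in>I. (f i)\<^sup>2)" using m unfolding sq by simp
    also have "\<dots> \<le> (\<Sum>i\<in>I. (cmod (f i))\<^sup>2)"
      by (rule sum_norm_le) (simp add: norm_power)
    finally show ?thesis .
  qed
  have "4 * m \<le> E\<^sup>2" using lower upper by (simp add: power2_eq_square)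
  then have "sqrt (4 * m) \<le> E" using E0 by (rule real_le_lsqrt[OF _ _, rotated 1]) 
  then show "2 * sqrt m \<le> (\<Sum>i\<in>I. cmod (f i))"
    by (simp add: real_sqrt_mult E_def)
  show "(\<Sum>i\<in>I. cmod (f i)) = 2 * sqrt m \<longleftrightarrow> (\<forall>i\<in>I. f i ^ 3 = of_real m * f i)"
    unfolding E_def[symmetric]
  proof
    assume E: "E = 2 * sqrt m"
    then have EE: "E / 2 * E = 2 * m" using m by simp
    show "\<forall>i\<in>I. f i ^ 3 = of_real m * f i"
    proof
      \<comment> \<open>Both estimates of the sum of squared moduli now meet at
        \<open>2 * m\<close>, so \<open>term_le\<close> is an equality at every index: a nonzero
        value has modulus \<open>E / 2\<close>, which is \<open>sqrt m\<close>.\<close>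
      fix i assume i: "i \<in> I"
      have "(\<Sum>j\<in>I. E / 2 * cmod (f j) - (cmod (f j))\<^sup>2) \<le> 0"
        using lower EE by (simp add: sum_subtractf E_def sum_distrib_left)
      then have "(\<Sum>j\<in>I. E / 2 * cmod (f j) - (cmod (f j))\<^sup>2) = 0"
        using term_le by (intro antisym sum_nonneg) auto
      then have "E / 2 * cmod (f i) = (cmod (f i))\<^sup>2"
        using term_le i fin by (subst (asm) sum_nonneg_eq_0_iff) auto
      then have "f i = 0 \<or> cmod (f i) = sqrt m"
        using E by (auto simp: power2_eq_square)
      \<comment> \<open>The modulus alone does not determine the cube; that the square is real and
        nonnegative does the rest.\<close>
      moreover have "(f i)\<^sup>2 = of_real ((cmod (f i))\<^sup>2)"
        using upper EE by (intro sum_cmod_sq_eq[OF fin sq _ i]) simp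
      ultimately show "f i ^ 3 = of_real m * f i"
        using m by (auto simp: power3_eq_cube power2_eq_square[of "f i"] simp flip: of_real_power)
    qed
  next
    assume cube: "\<forall>i\<in>I. f i ^ 3 = of_real m * f i"
    have sq': "(f i)\<^sup>2 = of_real m" if "i \<in> I" "f i \<noteq> 0" for i
      using cube that by (auto simp: power3_eq_cube power2_eq_square)
    \<comment> \<open>A nonzero value has square \<open>m\<close>, hence modulus
      \<open>sqrt m\<close>. Summing the two identities evaluates the sum of squared moduli once as
      \<open>2 * m\<close> and once as \<open>sqrt m * E\<close>.\<close>
    have cm: "of_real ((cmod (f i))\<^sup>2) = (f i)\<^sup>2 \<and> (cmod (f i))\<^sup>2 = sqrt m * cmod (f i)"
      if "i \<in> I" for i
    proof (cases "f i = 0")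
      case False
      have "(cmod (f i))\<^sup>2 = m"
        using arg_cong[OF sq'[OF that False], of cmod] m by (simp add: norm_power)
      moreover from this have "cmod (f i) = sqrt m"
        by (metis norm_ge_zero real_sqrt_unique)
      ultimately show ?thesis using sq'[OF that False] m by simp
    qed simp
    have "complex_of_real (\<Sum>i\<in>I. (cmod (f i))\<^sup>2) = of_real (2 * m)"
      unfolding sq[symmetric] of_real_sum by (intro sum.cong conjunct1[OF cm] refl)
    then have "2 * m = (\<Sum>i\<in>I. (cmod (f i))\<^sup>2)" by (simp only: of_real_eq_iff)
    also have "\<dots> = sqrt m * E"
      unfolding E_def sum_distrib_left using cm by (intro sum.cong) auto
    finally have *: "sqrt m * E = 2 * m" by simp
    \<comment> \<open>The factor \<open>sqrt m\<close> cannot be cancelled when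
      \<open>m = 0\<close>; there every cube, and so every value, is zero.\<close>
    show "E = 2 * sqrt m"
    proof (cases "m = 0")
      case True
      then show ?thesis using cube by (simp add: E_def)
    next
      case False
      have "sqrt m * E = sqrt m * (2 * sqrt m)" using * m by simp
      then show ?thesis using False m by simp
    qed
  qed
qed

section \<open>The energy bound for real symmetric matrices\<close>

lemma complex_triangularization:
  fixes A :: "complex mat"
  assumes "A \<in> carrier_mat n n"
  obtains U where "U \<in> carrier_mat n n" "upper_triangular U" "similar_mat A U"
  using char_poly_factorized[OF assms] schur_decomposition_exists[OF assms] by blast

text \<open>For the equality case, \<open>B = A\<^sup>3 - m A\<close> is real symmetric with only zero eigenvalues, so
  the sum of the squares of its entries, which is the trace of \<open>B\<^sup>2\<close>, vanishes.\<close>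

lemma matrix_energy_ge:
  fixes A :: "complex mat"
  assumes A: "A \<in> carrier_mat n n"
    and real: "\<And>i j. i < n \<Longrightarrow> j < n \<Longrightarrow> A $$ (i, j) \<in> \<real>"
    and sym: "\<And>i j. i < n \<Longrightarrow> j < n \<Longrightarrow> A $$ (i, j) = A $$ (j, i)"
    and m: "0 \<le> m" and tr: "mat_trace A = 0" and tr2: "mat_trace (A * A) = of_real (2 * m)"
  shows "2 * sqrt m \<le> matrix_energy A"
    and "matrix_energy A = 2 * sqrt m \<longleftrightarrow> A * A * A = of_real m \<cdot>\<^sub>m A"
proof -
  obtain U where U: "U \<in> carrier_mat n n" "upper_triangular U" and sim: "similar_mat A U"
    using complex_triangularization[OF A] .
  from sim obtain P Q where wit: "similar_mat_wit A U P Q"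
    unfolding similar_mat_def by auto
  note w = similar_mat_witD2[OF A wit]
  note E = matrix_energy_upper_triangular[OF A U sim]
  note mult = upper_triangular_mult
  have UU: "U * U \<in> carrier_mat n n" "upper_triangular (U * U)"
    and UUU: "U * U * U \<in> carrier_mat n n" "upper_triangular (U * U * U)"
    using U by (auto intro!: mult(1)[of _ n])
  note wit2 = similar_mat_wit_mult[OF wit wit]
  note wit3 = similar_mat_wit_mult[OF wit2 wit]
  have witm: "similar_mat_wit (of_real m \<cdot>\<^sub>m A) (of_real m \<cdot>\<^sub>m U) P Q"
    by (rule similar_mat_wit_smult[OF wit])
  have s1: "(\<Sum>i<n. U $$ (i, i)) = 0"
    using tr mat_trace_similar[OF wit] U unfolding mat_trace_def by auto
  have s2: "(\<Sum>i<n. (U $$ (i, i))\<^sup>2) = of_real (2 * m)"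
  proof -
    have "mat_trace (U * U) = (\<Sum>i<n. (U $$ (i, i))\<^sup>2)"
      unfolding mat_trace_def using U
      by (auto simp: mult(2)[OF U U] power2_eq_square simp del: index_mult_mat(1) intro!: sum.cong)
    then show ?thesis using tr2 mat_trace_similar[OF wit2] by simp
  qed
  show "2 * sqrt m \<le> matrix_energy A"
    unfolding E by (rule sum_cmod_ge(1)[OF _ m s1 s2]) simp
  have "matrix_energy A = 2 * sqrt m \<longleftrightarrow> (\<forall>i<n. (U $$ (i, i)) ^ 3 = of_real m * U $$ (i, i))"
    unfolding E by (subst sum_cmod_ge(2)[OF _ m s1 s2]) auto
  also have "\<dots> \<longleftrightarrow> A * A * A = of_real m \<cdot>\<^sub>m A"
  proof
    assume *: "A * A * A = of_real m \<cdot>\<^sub>m A"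
    \<comment> \<open>The matrix identity is transported to \<open>U\<close>, where its diagonal
      entries give the cubic equation for each eigenvalue.\<close>
    have "U * U * U = Q * (A * A * A) * P"
      by (rule similar_mat_witD(3)[OF refl similar_mat_wit_sym[OF wit3]])
    also have "\<dots> = of_real m \<cdot>\<^sub>m U"
      unfolding * by (rule similar_mat_witD(3)[OF refl similar_mat_wit_sym[OF witm], symmetric])
    finally have "U * U * U = of_real m \<cdot>\<^sub>m U" .
    then show "\<forall>i<n. (U $$ (i, i)) ^ 3 = of_real m * U $$ (i, i)"
      using mult(2)[OF UU U] mult(2)[OF U U] U
      by (metis carrier_matD(1,2) index_smult_mat(1) power3_eq_cube)
  next
    assume diag: "\<forall>i<n. (U $$ (i, i)) ^ 3 = of_real m * U $$ (i, i)"
    define B where "B = A * A * A - of_real m \<cdot>\<^sub>m A"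
    define V where "V = U * U * U - of_real m \<cdot>\<^sub>m U"
    have B: "B \<in> carrier_mat n n" and V: "V \<in> carrier_mat n n"
      using A U by (auto simp: B_def V_def)
    \<comment> \<open>\<open>V\<close> is \<open>B\<close> after the change of basis. It is
      triangular with zero diagonal, so \<open>V * V\<close> has zero diagonal and trace
      zero.\<close>
    have utV: "upper_triangular V"
      unfolding V_def by (rule upper_triangular_diff_smult[OF UUU U])
    have V0: "V $$ (i, i) = 0" if "i < n" for i
      unfolding V_def using that U diag mult(2)[OF UU U that] mult(2)[OF U U that]
      by (simp add: power3_eq_cube del: index_mult_mat(1))
    have "similar_mat_wit B V P Q"
      unfolding B_def V_def by (rule similar_mat_wit_diff[OF wit3 witm])
    from similar_mat_wit_mult[OF this this]
    have "mat_trace (B * B) = mat_trace (V * V)" by (rule mat_trace_similar)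
    also have "\<dots> = 0"
      unfolding mat_trace_def using V V0 mult(2)[OF V utV V utV]
      by (intro sum.neutral) (auto simp del: index_mult_mat(1))
    finally have trB: "mat_trace (B * B) = 0" .
    have AA: "(A * A) $$ (i, j) = (\<Sum>l<n. A $$ (i, l) * A $$ (l, j))" if "i < n" "j < n" for i j
      by (rule index_mult_mat_sum[OF A A that])
    have AAc: "A * A \<in> carrier_mat n n" using A by auto
    have B_eq: "B $$ (i, j) = (\<Sum>k<n. \<Sum>l<n. A $$ (i, l) * A $$ (l, k) * A $$ (k, j)) - of_real m * A $$ (i, j)"
      if "i < n" "j < n" for i j
      unfolding B_def using A that index_mult_mat_sum[OF AAc A that]
      by (simp add: AA sum_distrib_right del: index_mult_mat(1))
    have B_real: "B $$ (i, j) \<in> \<real>" if "i < n" "j < n" for i j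
      unfolding B_eq[OF that] using real that
      by (intro Reals_diff sum_in_Reals Reals_mult) auto
    \<comment> \<open>Reading the index path \<open>i, l, k, j\<close> backwards turns the terms of
      the entry at \<open>(i, j)\<close> into those at \<open>(j, i)\<close>, with the two sums
      interchanged.\<close>
    have B_sym: "B $$ (i, j) = B $$ (j, i)" if "i < n" "j < n" for i j
    proof -
      have "(\<Sum>k<n. \<Sum>l<n. A $$ (i, l) * A $$ (l, k) * A $$ (k, j))
          = (\<Sum>k<n. \<Sum>l<n. A $$ (j, k) * A $$ (k, l) * A $$ (l, i))"
      proof (intro sum.cong refl)
        fix k l assume "k \<in> {..<n}" "l \<in> {..<n}"
        then show "A $$ (i, l) * A $$ (l, k) * A $$ (k, j) = A $$ (j, k) * A $$ (k, l) * A $$ (l, i)"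
          using sym[of i l] sym[of l k] sym[of k j] that by (simp add: mult_ac)
      qed
      also have "\<dots> = (\<Sum>k<n. \<Sum>l<n. A $$ (j, l) * A $$ (l, k) * A $$ (k, i))"
        by (rule sum.swap)
      finally show ?thesis unfolding B_eq[OF that] B_eq[OF that(2,1)] using sym[OF that] by simp
    qed
    have "(\<Sum>(i, j)\<in>{..<n} \<times> {..<n}. (cmod (B $$ (i, j)))\<^sup>2) = 0"
    proof -
      have "complex_of_real (\<Sum>i<n. \<Sum>j<n. (cmod (B $$ (i, j)))\<^sup>2) = mat_trace (B * B)"
        unfolding mat_trace_mult[OF B B] of_real_sum
      proof (intro sum.cong refl)
        fix i j assume "i \<in> {..<n}" "j \<in> {..<n}"
        then have "B $$ (i, j) \<in> \<real>" "B $$ (j, i) = B $$ (i, j)" using B_real B_sym by auto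
        then show "complex_of_real ((cmod (B $$ (i, j)))\<^sup>2) = B $$ (i, j) * B $$ (j, i)"
          by (auto elim!: Reals_cases simp flip: power2_eq_square of_real_power)
      qed
      then have "(\<Sum>i<n. \<Sum>j<n. (cmod (B $$ (i, j)))\<^sup>2) = 0"
        unfolding trB of_real_eq_0_iff .
      then show ?thesis unfolding sum.cartesian_product .
    qed
    then have B0: "B $$ (i, j) = 0" if "i < n" "j < n" for i j
      using that sum_nonneg_eq_0_iff[of "{..<n} \<times> {..<n}" "\<lambda>(i, j). (cmod (B $$ (i, j)))\<^sup>2"]
      by auto
    show "A * A * A = of_real m \<cdot>\<^sub>m A"
    proof (rule eq_matI)
      fix i j assume "i < dim_row (of_real m \<cdot>\<^sub>m A)" "j < dim_col (of_real m \<cdot>\<^sub>m A)"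
      then have "i < n" "j < n" using A by auto
      then show "(A * A * A) $$ (i, j) = (of_real m \<cdot>\<^sub>m A) $$ (i, j)"
        using B0[of i j] A by (simp add: B_def del: index_mult_mat(1))
    qed (use A in auto)
  qed
  finally show "matrix_energy A = 2 * sqrt m \<longleftrightarrow> A * A * A = of_real m \<cdot>\<^sub>m A" .
qed

section \<open>Edges, components and walks of length 3\<close>

text \<open>A walk \<open>u, a, b, v\<close> is encoded by its inner vertices, so that the
  cardinality is an entry of the cube of the adjacency matrix.\<close>

definition walks3 :: "'a pair_pre_digraph \<Rightarrow> 'a \<Rightarrow> 'a \<Rightarrow> ('a \<times> 'a) set" where
  "walks3 G u v = {(a, b). (u, a) \<in> parcs G \<and> (a, b) \<in> parcs G \<and> (b, v) \<in> parcs G}"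

lemma sum_nth_distinct:
  assumes "distinct vs"
  shows "(\<Sum>i<length vs. g (vs ! i)) = sum g (set vs)"
  using sum.reindex_bij_betw[OF bij_betw_nth[OF assms refl refl], of g] .

lemma card_eq_sum_sum:
  assumes "finite V" "R \<subseteq> V \<times> V"
  shows "of_nat (card R) = (\<Sum>a\<in>V. \<Sum>b\<in>V. if (a, b) \<in> R then 1 else (0 :: 'b::semiring_1))"
proof -
  have "(\<Sum>a\<in>V. \<Sum>b\<in>V. if (a, b) \<in> R then 1 else (0 :: 'b))
      = (\<Sum>p\<in>V \<times> V. if p \<in> R then 1 else 0)"
    unfolding sum.cartesian_product by (intro sum.cong) auto
  also have "\<dots> = (\<Sum>p\<in>V \<times> V \<inter> R. 1)"
    using assms by (subst sum.inter_restrict) auto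
  also have "V \<times> V \<inter> R = R" using assms by auto
  finally show ?thesis by simp
qed

text \<open>An edge is two arcs, so \<open>card (parcs G) / 2\<close> is the number of edges.
  Absence of loops makes the trace zero, the trace of the squared adjacency matrix counts arcs, and
  its cube counts walks. The entrywise form of the cubic identity is doubled to stay within the
  natural numbers.\<close>

lemma graph_energy_ge:
  assumes "pair_graph G"
  shows "2 * sqrt (card (parcs G) / 2) \<le> graph_energy G" (is ?ge)
    and "graph_energy G = 2 * sqrt (card (parcs G) / 2) \<longleftrightarrow>
      (\<forall>u\<in>pverts G. \<forall>v\<in>pverts G.
        2 * card (walks3 G u v) = (if (u, v) \<in> parcs G then card (parcs G) else 0))" (is ?eq)
proof -
  interpret pair_graph G by fact
  obtain vs where vs: "set vs = pverts G" "distinct vs"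
    using finite_distinct_list[OF pair_finite_verts] by blast
  define n where "n = length vs"
  define A where "A = adjacency_matrix G vs"
  define adj where "adj = (\<lambda>u v. if (u, v) \<in> parcs G then 1 else (0 :: complex))"
  have A: "A \<in> carrier_mat n n" by (simp add: A_def n_def adjacency_matrix_def)
  have Aij: "A $$ (i, j) = adj (vs ! i) (vs ! j)" if "i < n" "j < n" for i j
    using that by (simp add: A_def n_def adjacency_matrix_def adj_def)
  have arcs: "parcs G \<subseteq> pverts G \<times> pverts G" using in_arcsD1 in_arcsD2 by auto
  note idx = sum_nth_distinct[OF vs(2), unfolded vs(1), folded n_def]
  have tr: "mat_trace A = 0"
    unfolding mat_trace_def using A Aij by (auto simp: adj_def dest: no_loops' intro!: sum.neutral)
  have "mat_trace (A * A) = (\<Sum>u\<in>pverts G. \<Sum>v\<in>pverts G. adj u v * adj v u)"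
    unfolding mat_trace_mult[OF A A] idx[symmetric] by (intro sum.cong) (auto simp: Aij)
  also have "\<dots> = of_nat (card (parcs G))"
    unfolding card_eq_sum_sum[OF pair_finite_verts arcs]
    by (intro sum.cong) (auto simp: adj_def arcs_symmetric)
  finally have tr2: "mat_trace (A * A) = of_real (2 * (card (parcs G) / 2))" by simp
  have real: "A $$ (i, j) \<in> \<real>" if "i < n" "j < n" for i j
    using Aij[OF that] by (simp add: adj_def)
  have sym: "A $$ (i, j) = A $$ (j, i)" if "i < n" "j < n" for i j
    using Aij that by (auto simp: adj_def arcs_symmetric)
  note energy = matrix_energy_ge[OF A real sym _ tr tr2]
  have E: "graph_energy G = matrix_energy A"
    unfolding A_def by (rule graph_energy_eq[OF vs(2,1)])
  show ?ge unfolding E by (rule energy(1)) auto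
  have cube: "(A * A * A) $$ (i, j) = of_nat (card (walks3 G (vs ! i) (vs ! j)))"
    if ij: "i < n" "j < n" for i j
  proof -
    have sub: "walks3 G (vs ! i) (vs ! j) \<subseteq> pverts G \<times> pverts G"
      using arcs by (auto simp: walks3_def)
    have AA: "A * A \<in> carrier_mat n n" using A by auto
    have "(A * A * A) $$ (i, j) = (\<Sum>l<n. \<Sum>k<n. A $$ (i, k) * A $$ (k, l) * A $$ (l, j))"
      unfolding index_mult_mat_sum[OF AA A ij]
      using ij by (intro sum.cong) (auto simp: index_mult_mat_sum[OF A A] sum_distrib_right
          simp del: index_mult_mat(1))
    also have "\<dots> = (\<Sum>b\<in>pverts G. \<Sum>a\<in>pverts G. adj (vs ! i) a * adj a b * adj b (vs ! j))"
      unfolding idx[symmetric] using ij by (intro sum.cong) (auto simp: Aij)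
    also have "\<dots> = (\<Sum>a\<in>pverts G. \<Sum>b\<in>pverts G. adj (vs ! i) a * adj a b * adj b (vs ! j))"
      by (rule sum.swap)
    also have "\<dots> = of_nat (card (walks3 G (vs ! i) (vs ! j)))"
      unfolding card_eq_sum_sum[OF pair_finite_verts sub]
      by (intro sum.cong) (auto simp: adj_def walks3_def)
    finally show ?thesis .
  qed
  have entry: "of_nat (card (walks3 G u v)) = of_real (card (parcs G) / 2) * adj u v \<longleftrightarrow>
      2 * card (walks3 G u v) = (if (u, v) \<in> parcs G then card (parcs G) else 0)" for u v
  proof -
    have "of_nat (card (walks3 G u v)) = of_real (card (parcs G) / 2) * adj u v \<longleftrightarrow>
        2 * (of_nat (card (walks3 G u v)) :: complex) = of_nat (card (parcs G)) * adj u v"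
      by (auto simp: field_simps)
    also have "\<dots> \<longleftrightarrow> complex_of_real (of_nat (2 * card (walks3 G u v)))
        = of_real (of_nat (if (u, v) \<in> parcs G then card (parcs G) else 0))"
      by (simp add: adj_def)
    finally show ?thesis unfolding of_real_eq_iff of_nat_eq_iff .
  qed
  have "graph_energy G = 2 * sqrt (card (parcs G) / 2) \<longleftrightarrow>
      A * A * A = of_real (card (parcs G) / 2) \<cdot>\<^sub>m A"
    unfolding E by (rule energy(2)) auto
  also have "\<dots> \<longleftrightarrow> (\<forall>i<n. \<forall>j<n. of_nat (card (walks3 G (vs ! i) (vs ! j)))
      = of_real (card (parcs G) / 2) * adj (vs ! i) (vs ! j))"
    using A unfolding mat_eq_iff
    by (simp add: cube Aij del: index_mult_mat(1) assoc_mult_mat)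
  also have "\<dots> \<longleftrightarrow> (\<forall>u\<in>pverts G. \<forall>v\<in>pverts G.
        2 * card (walks3 G u v) = (if (u, v) \<in> parcs G then card (parcs G) else 0))"
    unfolding entry vs(1)[symmetric] all_set_conv_all_nth n_def ..
  finally show ?eq .
qed

text \<open>Away from one root per component, the next vertex on a shortest path to the root selects
  an arc towards the root; together with its reversal this gives two arcs per non-root.\<close>

lemma (in pair_graph) card_verts_le_card_arcs:
  "2 * card (pverts G) \<le> card (parcs G) + 2 * card sccs_verts"
proof -
  \<comment> \<open>The choice depends on \<open>v\<close> only through \<open>scc_of v\<close>, so
    a whole component shares its root; \<open>d\<close> below is the distance to it.\<close>
  define root where "root = (\<lambda>v. SOME x. x \<in> scc_of v)"
  define R where "R = (\<lambda>S. SOME x. x \<in> S) ` sccs_verts"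
  define d where "d = (\<lambda>v. LEAST i. (v, root v) \<in> parcs G ^^ i)"
  define D where "D = {e \<in> parcs G. d (snd e) < d (fst e)}"
  have D: "\<exists>w. (v, w) \<in> parcs G \<and> d w < d v" if v: "v \<in> pverts G" "v \<notin> R" for v
  proof -
    have "root v \<in> scc_of v"
      unfolding root_def using in_scc_of_self[of v] v by (auto intro: someI)
    then have "(v, root v) \<in> (parcs G)\<^sup>*"
      unfolding scc_of_def reachable_def by (auto intro: rtrancl_on_rtranclI)
    then have "\<exists>i. (v, root v) \<in> parcs G ^^ i" by (simp add: rtrancl_power)
    then have dv: "(v, root v) \<in> parcs G ^^ d v"
      unfolding d_def by (rule LeastI_ex)
    have "root v \<in> R"
      unfolding R_def root_def using v by (auto simp: sccs_verts_conv_scc_of)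
    then have "root v \<noteq> v" using v by auto
    then obtain j where j: "d v = Suc j"
      using dv by (cases "d v") auto
    with dv obtain w where w: "(v, w) \<in> parcs G" "(w, root v) \<in> parcs G ^^ j"
      using relpow_Suc_D2 by metis
    \<comment> \<open>The next vertex lies in the same component and keeps the root, so the
      remaining path of length \<open>j\<close> bounds \<open>d w\<close>.\<close>
    have "w \<in> scc_of v"
      using w by (auto intro!: scc_ofI_reachable' reachable_adjI)
    then have "root w = root v"
      unfolding root_def by (simp add: scc_of_eq)
    then have "d w \<le> j"
      unfolding d_def using w(2) by (auto intro: Least_le)
    then show ?thesis using w j by auto
  qed
  have finR: "finite R" "card R \<le> card sccs_verts"
    unfolding R_def using finite_sccs_verts card_image_le by auto
  have finD: "finite D" unfolding D_def using pair_finite_arcs by auto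
  have "pverts G \<subseteq> R \<union> fst ` D"
    using D by (force simp: D_def)
  then have "card (pverts G) \<le> card (R \<union> fst ` D)"
    using finR finD by (intro card_mono) auto
  also have "\<dots> \<le> card R + card (fst ` D)" by (rule card_Un_le)
  also have "\<dots> \<le> card sccs_verts + card D"
    using finR card_image_le[OF finD] by (intro add_mono) auto
  finally have 1: "card (pverts G) \<le> card sccs_verts + card D" .
  \<comment> \<open>Since \<open>d\<close> drops strictly along \<open>D\<close>, no arc of
    \<open>D\<close> has its reversal in \<open>D\<close>.\<close>
  have "card (D \<union> D\<inverse>) = card D + card D"
    using finD by (subst card_Un_disjoint) (auto simp: D_def)
  moreover have "card (D \<union> D\<inverse>) \<le> card (parcs G)"
    using pair_finite_arcs by (intro card_mono) (auto simp: D_def arcs_symmetric)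
  ultimately show ?thesis using 1 by simp
qed

text \<open>Adjacent vertices differ because there are no loops, and the two inequalities separate
  the opposite ones, so the four arcs form a genuine cycle.\<close>

lemma simple_forest_no_quadrilateral:
  assumes "simple_forest G"
    and "(a, b) \<in> parcs G" "(b, c) \<in> parcs G" "(c, d) \<in> parcs G" "(d, a) \<in> parcs G"
    and "a \<noteq> c" "b \<noteq> d"
  shows False
proof -
  interpret pair_graph G using assms unfolding simple_forest_def by blast
  have "cycle [(a, b), (b, c), (c, d), (d, a)]"
    unfolding cycle_def awalk_def using assms no_loops' by (auto simp: in_arcsD1)
  then show False using assms unfolding simple_forest_def by fastforce
qed

section \<open>Stars\<close>

text \<open>Centre and leaf set are arbitrary, to describe a star inside any graph; an empty
  \<open>N\<close> covers the edgeless case.\<close>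

definition star_arcs :: "'a \<Rightarrow> 'a set \<Rightarrow> ('a \<times> 'a) set" where
  "star_arcs c N = {c} \<times> N \<union> N \<times> {c}"

lemma card_star_arcs:
  assumes "finite N" "c \<notin> N"
  shows "card (star_arcs c N) = 2 * card N"
  unfolding star_arcs_def using assms
  by (subst card_Un_disjoint) (auto simp: card_cartesian_product)

text \<open>A walk in a star alternates between centre and leaves. One of length 3 therefore joins
  the centre to a leaf, and its only freedom is the choice of one intermediate leaf.\<close>

lemma card_walks3_star:
  assumes "finite N" "c \<notin> N" "parcs G = star_arcs c N"
  shows "2 * card (walks3 G u v) = (if (u, v) \<in> parcs G then card (parcs G) else 0)"
proof -
  consider "u = c" "v \<in> N" | "u \<in> N" "v = c" | "(u, v) \<notin> parcs G"
    using assms by (auto simp: star_arcs_def)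
  then show ?thesis
  proof cases
    case 1
    then have "walks3 G u v = N \<times> {c}"
      using assms by (auto simp: walks3_def star_arcs_def)
    then show ?thesis
      using 1 assms card_star_arcs[of N c] by (simp add: card_cartesian_product) (simp add: star_arcs_def)
  next
    case 2
    then have "walks3 G u v = {c} \<times> N"
      using assms by (auto simp: walks3_def star_arcs_def)
    then show ?thesis
      using 2 assms card_star_arcs[of N c] by (simp add: card_cartesian_product) (simp add: star_arcs_def)
  next
    case 3
    then have "walks3 G u v = {}"
      using assms by (auto simp: walks3_def star_arcs_def)
    then show ?thesis using 3 by simp
  qed
qed

lemma simple_forest_star:
  assumes forest: "simple_forest G" and ne: "parcs G \<noteq> {}"
    and walks: "\<And>u v. u \<in> pverts G \<Longrightarrow> v \<in> pverts G \<Longrightarrow>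
      2 * card (walks3 G u v) = (if (u, v) \<in> parcs G then card (parcs G) else 0)"
  obtains c N where "c \<in> pverts G" "N \<subseteq> pverts G" "c \<notin> N" "parcs G = star_arcs c N"
proof -
  interpret pair_graph G using forest unfolding simple_forest_def by blast
  have fin: "finite (walks3 G u v)" for u v
    by (rule finite_subset[OF _ pair_finite_arcs]) (auto simp: walks3_def)
  have adjacent: "(w, x) \<in> parcs G"
    if "(w, u) \<in> parcs G" "(u, v) \<in> parcs G" "(v, x) \<in> parcs G" for u v w x
  proof (rule ccontr)
    assume "(w, x) \<notin> parcs G"
    moreover have "w \<in> pverts G" "x \<in> pverts G" using that in_arcsD1 in_arcsD2 by auto
    ultimately have "card (walks3 G w x) = 0" using walks[of w x] by simp
    then have "walks3 G w x = {}" using fin by simp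
    then show False using that by (auto simp: walks3_def)
  qed
  \<comment> \<open>The aim is an edge whose end \<open>v\<close> is a leaf.\<close>
  obtain u v where uv: "(u, v) \<in> parcs G" "\<And>x. (v, x) \<in> parcs G \<Longrightarrow> x = u"
  proof -
    from ne obtain u v where uv: "(u, v) \<in> parcs G" by auto
    show ?thesis
    proof (cases "\<forall>x. (v, x) \<in> parcs G \<longrightarrow> x = u")
      case True
      then show ?thesis using that uv by blast
    next
      case False
      then obtain x where x: "(v, x) \<in> parcs G" "x \<noteq> u" by blast
      \<comment> \<open>If \<open>v\<close> is no leaf, then \<open>u\<close> is one: a second
        neighbour \<open>w\<close> of \<open>u\<close> would give a path \<open>w, u, v, x\<close>,
        whose ends are adjacent and close a quadrilateral.\<close>
      have "w = v" if w: "(u, w) \<in> parcs G" for w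
      proof (rule ccontr)
        assume "w \<noteq> v"
        have "(w, u) \<in> parcs G" using w arcs_symmetric by blast
        from adjacent[OF this uv x(1)] have "(x, w) \<in> parcs G" using arcs_symmetric by blast
        from simple_forest_no_quadrilateral[OF forest \<open>(w, u) \<in> parcs G\<close> uv x(1) this]
        show False using \<open>w \<noteq> v\<close> x by blast
      qed
      then show ?thesis using that arcs_symmetric[OF uv] by blast
    qed
  qed
  define N where "N = {a. (u, a) \<in> parcs G}"
  have N: "N \<subseteq> pverts G" "u \<notin> N" using in_arcsD2 no_loops' by (auto simp: N_def)
  have finN: "finite N" using N pair_finite_verts finite_subset by blast
  \<comment> \<open>As \<open>v\<close> is a leaf, the last inner vertex must be \<open>u\<close>,
    so these walks count the neighbours of \<open>u\<close>. The star at \<open>u\<close> then has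
    as many arcs as the whole graph.\<close>
  have "walks3 G u v = N \<times> {u}"
    using uv arcs_symmetric by (auto simp: walks3_def N_def)
  then have "card (parcs G) = 2 * card N"
    using walks[of u v] uv in_arcsD1 in_arcsD2 by (auto simp: card_cartesian_product)
  then have "card (star_arcs u N) = card (parcs G)"
    using card_star_arcs[OF finN N(2)] by simp
  moreover have "star_arcs u N \<subseteq> parcs G"
    using arcs_symmetric by (auto simp: star_arcs_def N_def)
  ultimately have "parcs G = star_arcs u N"
    using card_subset_eq[OF pair_finite_arcs] by blast
  then show ?thesis using that[of u N] N uv in_arcsD1 by blast
qed

section \<open>Isomorphism and invariance of the energy\<close>

lemma digraph_iso_with_projI:
  assumes "pair_graph G" and bij: "bij_betw f (pverts G) (pverts H)"
    and arcs: "parcs H = map_prod f f ` parcs G"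
  shows "digraph_iso (with_proj G) (with_proj H)"
proof -
  interpret pair_graph G by fact
  define hom where "hom = \<lparr> iso_verts = f, iso_arcs = map_prod f f, iso_head = snd, iso_tail = fst \<rparr>"
  have inj: "inj_on f (pverts G)" using bij by (simp add: bij_betw_def)
  have sub: "parcs G \<subseteq> pverts G \<times> pverts G" using in_arcsD1 in_arcsD2 by auto
  have "inj_on (map_prod f f) (parcs G)"
    by (rule inj_on_subset[OF map_prod_inj_on[OF inj inj] sub])
  then have "digraph_isomorphism hom"
    unfolding digraph_isomorphism_def using inj wf_digraph by (auto simp: hom_def)
  moreover have "with_proj H = app_iso hom (with_proj G)"
    using bij arcs by (simp add: app_iso_def with_proj_def hom_def bij_betw_def)
  ultimately show ?thesis unfolding digraph_iso_def by blast
qed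

text \<open>An enumeration of the vertices of \<open>G\<close>, carried along the isomorphism,
  yields literally the same adjacency matrix for \<open>H\<close>.\<close>

lemma graph_energy_iso:
  assumes "pair_graph G" and "digraph_iso (with_proj G) (with_proj H)"
  shows "graph_energy G = graph_energy H"
proof -
  interpret pair_graph G by fact
  obtain hom where hom: "digraph_isomorphism hom" "with_proj H = app_iso hom (with_proj G)"
    using assms unfolding digraph_iso_def by blast
  define f where "f = iso_verts hom"
  have inj: "inj_on f (pverts G)" using hom(1) by (simp add: digraph_isomorphism_def f_def)
  have verts: "pverts H = f ` pverts G"
    using arg_cong[OF hom(2), of verts] by (simp add: f_def)
  have proj: "iso_tail hom = fst" "iso_head hom = snd"
    using arg_cong[OF hom(2), of tail] arg_cong[OF hom(2), of head] by simp_all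
  \<comment> \<open>Tail and head are \<open>fst\<close> and \<open>snd\<close> on both sides, which
    forces the arc map to be induced by the vertex map.\<close>
  have "iso_arcs hom e = map_prod f f e" if "e \<in> parcs G" for e
    using hom(1) that unfolding digraph_isomorphism_def proj f_def
    by (auto simp: prod_eq_iff)
  then have arcs: "parcs H = map_prod f f ` parcs G"
    using arg_cong[OF hom(2), of arcs] by auto
  obtain vs where vs: "set vs = pverts G" "distinct vs"
    using finite_distinct_list[OF pair_finite_verts] by blast
  have iff: "(f u, f v) \<in> parcs H \<longleftrightarrow> (u, v) \<in> parcs G" if "u \<in> pverts G" "v \<in> pverts G" for u v
  proof
    assume "(f u, f v) \<in> parcs H"
    then obtain a b where ab: "(a, b) \<in> parcs G" "f u = f a" "f v = f b" by (auto simp: arcs)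
    then have "u = a" "v = b" using that inj_onD[OF inj] in_arcsD1 in_arcsD2 by blast+
    then show "(u, v) \<in> parcs G" using ab by simp
  qed (force simp: arcs)
  have "adjacency_matrix H (map f vs) = adjacency_matrix G vs"
    unfolding adjacency_matrix_def using iff by (intro eq_matI) (auto simp: vs(1)[symmetric])
  moreover have "distinct (map f vs)" "set (map f vs) = pverts H"
    using vs inj verts by (auto simp: distinct_map)
  ultimately show ?thesis
    using graph_energy_eq[OF vs(2,1)] graph_energy_eq[of "map f vs" H] by simp
qed

lemma star_forest_simps:
  assumes "1 \<le> k" "k \<le> n"
  shows "pverts (star_forest n k) = {0..<n}"
    and "parcs (star_forest n k) = star_arcs 0 {1..n - k}"
  using assms by (auto simp: star_forest_def star_def star_arcs_def)

text \<open>The centre goes to \<open>0\<close>, the leaves to \<open>{1..n - k}\<close>, and the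
  remaining \<open>k - 1\<close> isolated vertices to \<open>{n - k<..<n}\<close>.\<close>

lemma digraph_iso_star_forest:
  assumes "pair_graph G" and k: "1 \<le> k" "k \<le> n" and n: "card (pverts G) = n"
    and star: "c \<in> pverts G" "N \<subseteq> pverts G" "c \<notin> N" "parcs G = star_arcs c N"
    and N: "card N = n - k"
  shows "digraph_iso (with_proj G) (with_proj (star_forest n k))"
proof -
  interpret pair_graph G by fact
  define M where "M = pverts G - insert c N"
  have fin: "finite N" "finite M" using pair_finite_verts finite_subset[OF star(2)] by (auto simp: M_def)
  have "card (insert c N) = Suc (n - k)" using fin star N by simp
  then have M: "card M = k - 1"
    unfolding M_def using star n k fin by (subst card_Diff_subset) auto
  obtain g where g: "bij_betw g N {1..n - k}"
    using finite_same_card_bij[OF fin(1), of "{1..n - k}"] N by auto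
  obtain h where h: "bij_betw h M {n - k<..<n}"
    using finite_same_card_bij[OF fin(2), of "{n - k<..<n}"] M k by auto
  define f where "f = (\<lambda>v. if v = c then 0 else if v \<in> N then g v else h v)"
  have fN: "bij_betw f N {1..n - k}"
    using g star by (subst bij_betw_cong[of _ _ g]) (auto simp: f_def)
  have fM: "bij_betw f M {n - k<..<n}"
    using h star by (subst bij_betw_cong[of _ _ h]) (auto simp: f_def M_def)
  have fc: "bij_betw f {c} {0}" by (simp add: f_def bij_betw_def)
  have "bij_betw f ({c} \<union> N \<union> M) ({0} \<union> {1..n - k} \<union> {n - k<..<n})"
    by (intro bij_betw_combine fc fN fM) auto
  moreover have "{c} \<union> N \<union> M = pverts G" using star by (auto simp: M_def)
  moreover have "{0} \<union> {1..n - k} \<union> {n - k<..<n} = {0..<n}" using k by auto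
  ultimately have "bij_betw f (pverts G) (pverts (star_forest n k))"
    using star_forest_simps(1)[OF k] by simp
  moreover have "parcs (star_forest n k) = map_prod f f ` parcs G"
  proof -
    have "f ` N = {1..n - k}" "f c = 0" using fN by (auto simp: bij_betw_def f_def)
    moreover have "map_prod f f ` star_arcs c N = star_arcs (f c) (f ` N)"
      unfolding star_arcs_def by force
    ultimately show ?thesis
      unfolding star_forest_simps(2)[OF k] star(4) by simp
  qed
  ultimately show ?thesis by (rule digraph_iso_with_projI[OF assms(1)])
qed

section \<open>The star forest as a forest with \<open>k\<close> components\<close>

lemma pair_graph_star:
  assumes "finite (pverts G)" "c \<in> pverts G" "N \<subseteq> pverts G" "c \<notin> N" "parcs G = star_arcs c N"
  shows "pair_graph G"
proof -
  have "finite N" using assms finite_subset by blast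
  then show ?thesis
    using assms by unfold_locales (auto simp: star_arcs_def symmetric_def sym_def)
qed

text \<open>Every other vertex of a walk in a star is the centre.\<close>

lemma simple_forest_star_arcs:
  assumes "pair_graph G" "c \<notin> N" "parcs G = star_arcs c N"
  shows "simple_forest G"
proof -
  interpret pair_graph G by fact
  have "\<not> 3 \<le> length p" if cycle: "cycle p" for p
  proof
    assume "3 \<le> length p"
    then obtain e1 e2 e3 q where p: "p = e1 # e2 # e3 # q"
      by (metis One_nat_def Suc_le_length_iff numeral_3_eq_3)
    obtain u where "awalk u p u" "distinct (tl (pawalk_verts u p))"
      using cycle unfolding cycle_def by auto
    moreover have start: "x \<in> set (pawalk_verts x q')" if "pcas x q' y" for x y q'
      using that by (cases q') auto
    \<comment> \<open>From a leaf, the centre is visited after the first and the third arc. From the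
      centre, it recurs after the second and the fourth; with exactly three arcs the walk would end
      at a leaf and not close up.\<close>
    ultimately show False
      using assms(2) unfolding p assms(3) awalk_def
      by (cases e1; cases e2; cases e3; cases q) (auto simp: star_arcs_def assms(3) dest: start)
  qed
  then show ?thesis using assms(1) unfolding simple_forest_def by blast
qed

lemma sccs_verts_star:
  assumes "pair_graph G" "c \<in> pverts G" "N \<subseteq> pverts G" "c \<notin> N" "parcs G = star_arcs c N"
  shows "pre_digraph.sccs_verts (with_proj G)
    = insert (insert c N) ((\<lambda>v. {v}) ` (pverts G - insert c N))"
proof -
  interpret pair_graph G by fact
  have centre: "insert c N \<subseteq> scc_of c"
    using assms in_scc_of_self by (auto simp: star_arcs_def intro!: scc_ofI_reachable' reachable_adjI)
  \<comment> \<open>Invariant along reachability: no arc leaves the star, and a vertex outside it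
    has no arcs.\<close>
  have out: "v \<in> (if u \<in> insert c N then insert c N else {u})" if "u \<rightarrow>\<^sup>*\<^bsub>with_proj G\<^esub> v" for u v
    using that
  proof (induction rule: reachable_induct)
    case (step x y)
    then show ?case using assms by (auto simp: star_arcs_def split: if_splits)
  qed auto
  have 1: "scc_of u = insert c N" if "u \<in> insert c N" for u
  proof -
    have "scc_of u = scc_of c" using centre that by (intro scc_of_eq) auto
    moreover have "scc_of c \<subseteq> insert c N" using out[of c] by (auto simp: scc_of_def)
    ultimately show ?thesis using centre by auto
  qed
  have 2: "scc_of u = {u}" if "u \<in> pverts G - insert c N" for u
    using out[of u] in_scc_of_self[of u] that by (auto simp: scc_of_def split: if_splits)
  have "pverts G = insert c N \<union> (pverts G - insert c N)" using assms by auto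
  then have "scc_of ` pverts G = scc_of ` insert c N \<union> scc_of ` (pverts G - insert c N)"
    by (metis image_Un)
  also have "scc_of ` insert c N = {insert c N}" using 1 by (auto simp: image_iff)
  also have "scc_of ` (pverts G - insert c N) = (\<lambda>v. {v}) ` (pverts G - insert c N)"
    using 2 by (intro image_cong) auto
  finally show ?thesis unfolding sccs_verts_conv_scc_of by simp
qed

lemma star_forest_in_forests:
  assumes k: "1 \<le> k" "k \<le> n"
  shows "star_forest n k \<in> forests n k"
proof -
  let ?S = "star_forest n k"
  note s = star_forest_simps[OF k]
  have star: "0 \<in> pverts ?S" "{1..n - k} \<subseteq> pverts ?S" "0 \<notin> {1..n - k}"
    using k by (auto simp: s)
  have pg: "pair_graph ?S" by (rule pair_graph_star[OF _ star s(2)]) (simp add: s)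
  have rest: "pverts ?S - insert 0 {1..n - k} = {n - k<..<n}" using k by (auto simp: s)
  \<comment> \<open>The star is one component, distinct from the singletons because it contains
    \<open>0\<close>.\<close>
  have "card (pre_digraph.sccs_verts (with_proj ?S)) = Suc (card ((\<lambda>v. {v}) ` {n - k<..<n}))"
    unfolding sccs_verts_star[OF pg star s(2)] rest
    by (subst card_insert_disjoint) auto
  also have "\<dots> = k" using k by (subst card_image) auto
  finally show ?thesis
    using simple_forest_star_arcs[OF pg star(3) s(2)] by (simp add: forests_def s)
qed

section \<open>Minimality and uniqueness of the star forest\<close>

theorem theorem8:
  fixes n k :: nat
  assumes "1 \<le> k" and "k \<le> n"
  shows "star_forest n k \<in> forests n k
    \<and> (\<forall>F :: 'a pair_pre_digraph. F \<in> forests n k \<longrightarrow>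
          graph_energy (star_forest n k) \<le> graph_energy F
        \<and> (graph_energy F = graph_energy (star_forest n k)
              \<longleftrightarrow> digraph_iso (with_proj F) (with_proj (star_forest n k))))
    \<and> graph_energy (star_forest n k) = 2 * sqrt (real (n - k))"
proof -
  let ?S = "star_forest n k"
  note s = star_forest_simps[OF assms]
  have S: "?S \<in> forests n k" by (rule star_forest_in_forests[OF assms])
  then have pg: "pair_graph ?S" by (simp add: forests_def simple_forest_def)
  have "card (parcs ?S) = 2 * (n - k)"
    unfolding s by (subst card_star_arcs) auto
  moreover have "2 * card (walks3 ?S u v) = (if (u, v) \<in> parcs ?S then card (parcs ?S) else 0)" for u v
    by (rule card_walks3_star[OF _ _ s(2)]) auto
  ultimately have energy: "graph_energy ?S = 2 * sqrt (real (n - k))"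
    using graph_energy_ge(2)[OF pg] by simp
  have "graph_energy ?S \<le> graph_energy F \<and>
      (graph_energy F = graph_energy ?S \<longleftrightarrow> digraph_iso (with_proj F) (with_proj ?S))"
    if F: "F \<in> forests n k" for F :: "'a pair_pre_digraph"
  proof -
    have forest: "simple_forest F" and n: "card (pverts F) = n"
      and k: "card (pre_digraph.sccs_verts (with_proj F)) = k"
      using F by (auto simp: forests_def)
    interpret pair_graph F using forest by (simp add: simple_forest_def)
    have pgF: "pair_graph F" ..
    note ge = graph_energy_ge[OF pgF]
    have arcs: "real (n - k) \<le> card (parcs F) / 2"
      using card_verts_le_card_arcs n k assms by simp
    then have "2 * sqrt (real (n - k)) \<le> 2 * sqrt (card (parcs F) / 2)" by simp
    with ge(1) have le: "graph_energy ?S \<le> graph_energy F" unfolding energy by linarith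
    have "digraph_iso (with_proj F) (with_proj ?S)" if eq: "graph_energy F = graph_energy ?S"
    proof -
      \<comment> \<open>Equal energies squeeze the number of edges down to \<open>n - k\<close>, so
        the energy bound for \<open>F\<close> itself is attained.\<close>
      have "sqrt (card (parcs F) / 2) \<le> sqrt (real (n - k))"
        using ge(1) eq energy by simp
      then have "card (parcs F) / 2 = real (n - k)" using arcs by simp
      then have card: "card (parcs F) = 2 * (n - k)" by simp
      then have "graph_energy F = 2 * sqrt (card (parcs F) / 2)" using eq energy by simp
      with ge(2) have walks: "2 * card (walks3 F u v) = (if (u, v) \<in> parcs F then card (parcs F) else 0)"
        if "u \<in> pverts F" "v \<in> pverts F" for u v
        using that by blast
      obtain c N where star: "c \<in> pverts F" "N \<subseteq> pverts F" "c \<notin> N" "parcs F = star_arcs c N"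
      proof (cases "parcs F = {}")
        case True
        \<comment> \<open>Without edges, any vertex is the centre of a star with no leaves; one
          exists since \<open>n\<close> is positive.\<close>
        have "pverts F \<noteq> {}" using n assms by auto
        then show ?thesis using that[of _ "{}"] True by (auto simp: star_arcs_def)
      next
        case False
        show ?thesis by (rule simple_forest_star[OF forest False walks that])
      qed
      have "finite N" using star pair_finite_verts finite_subset by blast
      then have "card N = n - k" using card_star_arcs[of N c] star card by simp
      then show ?thesis by (rule digraph_iso_star_forest[OF pgF assms n star])
    qed
    then show ?thesis using le graph_energy_iso[OF pgF, of ?S] by blast
  qed
  with S energy show ?thesis by blast
qed

end
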